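(* Let $E$ be a finite set, $M$ a symmetric $|E|\times|E|$ matrix over $GF(2)$ with rows and columns indexed by $E$, and $a,b\in E$ distinct. Then $D(M_{ab})=D(M)_{ab}$.
   Context: $D(M)$ is the set system on $E$ whose feasible sets are those $A\subseteq E$ for which the principal submatrix $M[A]$ (rows and columns indexed by $A$) is non-singular over $GF(2)$; $M[\emptyset]$ is considered non-singular. $M_{ab}$ is the matrix obtained from $M$ by adding the column of $b$ to the column of $a$, and then in the resulting matrix adding the row of $b$ to the row of $a$. For a set system $D=(E,\mathcal{F})$, $D_{ab}=(E,\mathcal{F}_{ab})$ with $\mathcal{F}_{ab}=\mathcal{F}\triangle\{X\cup\{a\}: X\cup\{b\}\in\mathcal{F},\ X\subseteq E\setminus\{a,b\}\}$, where $\triangle$ is symmetric difference. *)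

theory Defs
  imports "HOL-Analysis.Determinants" "HOL-Library.Z2"
begin

text \<open>
  A matrix with rows and columns indexed by a finite set \<open>E\<close> is a function \<open>'e \<Rightarrow> 'e \<Rightarrow> 'k\<close> of which
  only the values on \<open>E \<times> E\<close> matter; \<open>GF(2)\<close> is the field \<^typ>\<open>bit\<close>.  The index set is a set and not
  a type because the submatrices \<open>M[A]\<close> are indexed by the varying subsets \<open>A\<close> of \<open>E\<close>.
\<close>

definition symmetric_on :: "'e set \<Rightarrow> ('e \<Rightarrow> 'e \<Rightarrow> 'k) \<Rightarrow> bool" where
  "symmetric_on E M \<longleftrightarrow> (\<forall>i\<in>E. \<forall>j\<in>E. M i j = M j i)"

text \<open>
  The determinant of the principal submatrix \<open>M[A]\<close>: the definition of \<^const>\<open>det\<close> with the finite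
  index type replaced by the finite set \<open>A\<close>.
\<close>

definition principal_minor :: "('e \<Rightarrow> 'e \<Rightarrow> 'k::comm_ring_1) \<Rightarrow> 'e set \<Rightarrow> 'k" where
  "principal_minor M A = (\<Sum>p\<in>{p. p permutes A}. of_int (sign p) * (\<Prod>i\<in>A. M i (p i)))"

definition principal_nonsingular :: "('e \<Rightarrow> 'e \<Rightarrow> 'k::field) \<Rightarrow> 'e set \<Rightarrow> bool" where
  "principal_nonsingular M A \<longleftrightarrow> principal_minor M A \<noteq> 0"

lemma principal_minor_eq_det:
  fixes M :: "'e \<Rightarrow> 'e \<Rightarrow> 'k::comm_ring_1" and f :: "'n::finite \<Rightarrow> 'e"
  assumes f: "bij_betw f UNIV A"
  shows "principal_minor M A = det (\<chi> i j. M (f i) (f j))"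
proof -
  let ?g = "\<lambda>\<pi> x. if x \<in> A then f (\<pi> (inv_into UNIV f x)) else x"
  have inj: "inj f" using f by (simp add: bij_betw_def)
  have im: "f ` UNIV = A" using f by (simp add: bij_betw_def)
  have g: "?g p = map_permutation UNIV f p" for p
    by (auto simp: fun_eq_iff map_permutation_def restrict_id_def im)
  have "principal_minor M A
      = (\<Sum>p | p permutes (UNIV :: 'n set). of_int (sign (?g p)) * (\<Prod>i\<in>A. M i (?g p i)))"
    unfolding principal_minor_def
    by (rule sum.reindex_bij_betw[OF bij_betw_permutations[OF f], symmetric])
  also have "\<dots> = (\<Sum>p | p permutes (UNIV :: 'n set). of_int (sign p) * (\<Prod>i\<in>UNIV. M (f i) (f (p i))))"
  proof (rule sum.cong[OF refl])
    fix p :: "'n \<Rightarrow> 'n" assume "p \<in> {p. p permutes UNIV}"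
    then have p: "p permutes UNIV" by simp
    have "sign (?g p) = sign p"
      unfolding g by (rule sign_map_permutation) (use inj p in auto)
    moreover have "(\<Prod>i\<in>A. M i (?g p i)) = (\<Prod>i\<in>UNIV. M (f i) (?g p (f i)))"
      by (rule prod.reindex_bij_betw[OF f, symmetric])
    moreover have "?g p (f i) = f (p i)" for i
      using inj im by auto
    ultimately show "of_int (sign (?g p)) * (\<Prod>i\<in>A. M i (?g p i))
        = of_int (sign p) * (\<Prod>i\<in>UNIV. M (f i) (f (p i)))" by simp
  qed
  finally show ?thesis by (simp add: det_def)
qed

lemma principal_nonsingular_empty: "principal_nonsingular M {}"
  by (simp add: principal_nonsingular_def principal_minor_def)

type_synonym 'e set_system = "'e set \<times> 'e set set"

text \<open>\<open>D(M)\<close>\<close>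

definition matrix_set_system :: "'e set \<Rightarrow> ('e \<Rightarrow> 'e \<Rightarrow> bit) \<Rightarrow> 'e set_system" where
  "matrix_set_system E M = (E, {A. A \<subseteq> E \<and> principal_nonsingular M A})"

definition add_column :: "'e \<Rightarrow> 'e \<Rightarrow> ('e \<Rightarrow> 'e \<Rightarrow> bit) \<Rightarrow> 'e \<Rightarrow> 'e \<Rightarrow> bit" where
  "add_column a b M = (\<lambda>i j. if j = a then M i a + M i b else M i j)"

definition add_row :: "'e \<Rightarrow> 'e \<Rightarrow> ('e \<Rightarrow> 'e \<Rightarrow> bit) \<Rightarrow> 'e \<Rightarrow> 'e \<Rightarrow> bit" where
  "add_row a b M = (\<lambda>i j. if i = a then M a j + M b j else M i j)"

text \<open>\<open>M\<^sub>a\<^sub>b\<close>\<close>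

definition matrix_slide :: "'e \<Rightarrow> 'e \<Rightarrow> ('e \<Rightarrow> 'e \<Rightarrow> bit) \<Rightarrow> 'e \<Rightarrow> 'e \<Rightarrow> bit" where
  "matrix_slide a b M = add_row a b (add_column a b M)"

text \<open>\<open>D\<^sub>a\<^sub>b\<close>\<close>

definition set_system_slide :: "'e \<Rightarrow> 'e \<Rightarrow> 'e set_system \<Rightarrow> 'e set_system" where
  "set_system_slide a b = (\<lambda>(E, F).
     (E, sym_diff F {X \<union> {a} | X. X \<union> {b} \<in> F \<and> X \<subseteq> E - {a, b}}))"

end

theory Submission
  imports Defs
begin

text \<open>
  The only interesting case is \<open>a \<in> A\<close>, \<open>b \<notin> A\<close>.  Bilinearity in row and column \<open>a\<close> expands the
  minor of \<open>M\<^sub>a\<^sub>b\<close> on \<open>A\<close> into four terms: the minors of \<open>M\<close> on \<open>A\<close> and on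
  \<open>A\<close> with \<open>a\<close> exchanged for \<open>b\<close>, and two mixed terms that are transposes of each other because
  \<open>M\<close> is symmetric, and hence cancel in characteristic 2.
\<close>

lemma principal_minor_cong:
  assumes "\<And>i j. i \<in> A \<Longrightarrow> j \<in> A \<Longrightarrow> M i j = N i j"
  shows "principal_minor M A = principal_minor N A"
  unfolding principal_minor_def
  by (intro sum.cong refl arg_cong2[where f = "(*)"] prod.cong)
    (auto simp: assms permutes_in_image)

text \<open>Summing over inverse permutations leaves signs unchanged, and reindexing each product
  along \<open>p\<close> moves the permutation from the row index to the column index.\<close>

lemma principal_minor_transpose:
  fixes M :: "'e \<Rightarrow> 'e \<Rightarrow> 'k::comm_ring_1"
  assumes "finite A"
  shows "principal_minor (\<lambda>i j. M j i) A = principal_minor M A"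
proof -
  have "principal_minor (\<lambda>i j. M j i) A
      = (\<Sum>p | p permutes A. of_int (sign (inv p)) * (\<Prod>i\<in>A. M (inv p i) i))"
    unfolding principal_minor_def by (rule sum_permutations_inverse)
  also have "\<dots> = principal_minor M A"
    unfolding principal_minor_def
  proof (rule sum.cong[OF refl])
    fix p assume "p \<in> {p. p permutes A}"
    then have p: "p permutes A" by simp
    have "(\<Prod>i\<in>A. M (inv p i) i) = (\<Prod>i\<in>A. M (inv p (p i)) (p i))"
      by (rule prod.permute[OF p, unfolded o_def])
    also have "\<dots> = (\<Prod>i\<in>A. M i (p i))"
      by (simp add: permutes_inverses[OF p])
    finally show "of_int (sign (inv p)) * (\<Prod>i\<in>A. M (inv p i) i)
        = of_int (sign p) * (\<Prod>i\<in>A. M i (p i))"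
      using permutation_permutes[of p] p assms by (auto simp: sign_inverse)
  qed
  finally show ?thesis .
qed

lemma principal_minor_image:
  fixes M :: "'e \<Rightarrow> 'e \<Rightarrow> 'k::comm_ring_1"
  assumes "finite A" and f: "inj_on f A"
  shows "principal_minor (\<lambda>i j. M (f i) (f j)) A = principal_minor M (f ` A)"
proof -
  have bij: "bij_betw f A (f ` A)"
    using f by (simp add: bij_betw_def)
  \<comment> \<open>The right-hand side is the form in which \<open>bij_betw_permutations\<close>
    gives the induced map.\<close>
  have g: "map_permutation A f
      = (\<lambda>p x. if x \<in> f ` A then f (p (inv_into A f x)) else x)"
    by (auto simp: fun_eq_iff map_permutation_def restrict_id_def)
  have "principal_minor M (f ` A) = (\<Sum>p | p permutes A.
      of_int (sign (map_permutation A f p)) * (\<Prod>i\<in>f ` A. M i (map_permutation A f p i)))"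
    unfolding principal_minor_def g
    by (rule sum.reindex_bij_betw[OF bij_betw_permutations[OF bij], symmetric])
  also have "\<dots> = principal_minor (\<lambda>i j. M (f i) (f j)) A"
    unfolding principal_minor_def
    using assms by (intro sum.cong refl)
      (simp add: prod.reindex sign_map_permutation map_permutation_apply)
  finally show ?thesis ..
qed

text \<open>Composition with the transposition of \<open>k\<close> and \<open>l\<close> pairs even
  with odd permutations of equal product. A minor equal to its own negative would not suffice, since
  that says nothing in characteristic 2.\<close>

lemma principal_minor_identical_rows:
  fixes M :: "'e \<Rightarrow> 'e \<Rightarrow> 'k::comm_ring_1"
  assumes A: "finite A" and k: "k \<in> A" and l: "l \<in> A" and "k \<noteq> l"
    and eq: "\<And>j. M k j = M l j"
  shows "principal_minor M A = 0"
proof -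
  let ?t = "Transposition.transpose k l" and ?g = "\<lambda>p. \<Prod>i\<in>A. M i (p i)"
  \<comment> \<open>\<open>?h True\<close> and \<open>?h False\<close> separate the positive from
    the negative terms of the expansion.\<close>
  let ?h = "\<lambda>e p. if evenperm p = e then ?g p else 0"
  have t: "?t permutes A"
    using k l by (rule permutes_swap_id)
  have M: "M (?t i) j = M i j" for i j
    using eq by (simp add: Transposition.transpose_def)
  have g: "?g (p \<circ> ?t) = ?g p" for p
  proof -
    have "?g (p \<circ> ?t) = (\<Prod>i\<in>A. M (?t i) (p (?t i)))"
      by (simp add: M)
    also have "\<dots> = ?g p"
      by (rule prod.permute[OF t, unfolded o_def, symmetric])
    finally show ?thesis .
  qed
  have "sum (?h True) {p. p permutes A} = (\<Sum>p | p permutes A. ?h True (p \<circ> ?t))"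
    by (rule sum_permutations_compose_right[OF t])
  also have "\<dots> = sum (?h False) {p. p permutes A}"
  proof (rule sum.cong[OF refl])
    fix p assume "p \<in> {p. p permutes A}"
    then have "evenperm (p \<circ> ?t) \<longleftrightarrow> \<not> evenperm p"
      using A \<open>k \<noteq> l\<close> permutation_permutes[of p]
      by (auto simp: evenperm_comp permutation_swap_id evenperm_swap)
    then show "?h True (p \<circ> ?t) = ?h False p"
      using g[of p] by simp
  qed
  finally have "sum (?h True) {p. p permutes A} - sum (?h False) {p. p permutes A} = 0"
    by simp
  moreover have "principal_minor M A
      = sum (?h True) {p. p permutes A} - sum (?h False) {p. p permutes A}"
    unfolding principal_minor_def sum_subtractf[symmetric]
    by (intro sum.cong refl) (simp add: sign_def)
  ultimately show ?thesis by simp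
qed

text \<open>The map \<open>id(a := b)\<close> redirects index \<open>a\<close> to \<open>b\<close>,
  so the second summand is the minor with row \<open>a\<close> overwritten by row \<open>b\<close>.
  Only the factor at \<open>a\<close> differs among the products.\<close>

lemma principal_minor_add_row:
  assumes A: "finite A" "a \<in> A"
  shows "principal_minor (add_row a b M) A
    = principal_minor M A + principal_minor (\<lambda>i. M ((id(a := b)) i)) A"
proof -
  have "(\<Prod>i\<in>A. add_row a b M i (p i))
      = (\<Prod>i\<in>A. M i (p i)) + (\<Prod>i\<in>A. M ((id(a := b)) i) (p i))" for p
  proof -
    have "(\<Prod>i\<in>A - {a}. N i (p i)) = (\<Prod>i\<in>A - {a}. M i (p i))"
      if "\<And>i. i \<noteq> a \<Longrightarrow> N i = M i" for N :: "'a \<Rightarrow> 'a \<Rightarrow> bit"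
      using that by (intro prod.cong) auto
    note rest = this[of "add_row a b M"] this[of "\<lambda>i. M ((id(a := b)) i)"]
    have "add_row a b M a (p a) = M a (p a) + M ((id(a := b)) a) (p a)"
      by (simp add: add_row_def)
    then show ?thesis
      unfolding prod.remove[OF A] using rest
      by (simp only: distrib_right) (simp add: add_row_def)
  qed
  then show ?thesis
    by (simp only: principal_minor_def distrib_left sum.distrib)
qed

lemma principal_minor_add_column:
  assumes A: "finite A" "a \<in> A"
  shows "principal_minor (add_column a b M) A
    = principal_minor M A + principal_minor (\<lambda>i j. M i ((id(a := b)) j)) A"
proof -
  have "add_column a b M = (\<lambda>i j. add_row a b (\<lambda>i j. M j i) j i)"
    by (simp add: add_column_def add_row_def fun_eq_iff)
  then have "principal_minor (add_column a b M) A = principal_minor (add_row a b (\<lambda>i j. M j i)) A"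
    by (simp only: principal_minor_transpose[OF A(1), of "add_row a b (\<lambda>i j. M j i)"])
  also have "\<dots> = principal_minor (\<lambda>i j. M j i) A
      + principal_minor (\<lambda>i j. M j ((id(a := b)) i)) A"
    by (rule principal_minor_add_row[OF A])
  finally show ?thesis
    by (simp only: principal_minor_transpose[OF A(1), of M]
        principal_minor_transpose[OF A(1), of "\<lambda>i j. M i ((id(a := b)) j)"])
qed

lemma principal_minor_slide_notin:
  assumes "a \<notin> A"
  shows "principal_minor (matrix_slide a b M) A = principal_minor M A"
  using assms
  by (intro principal_minor_cong) (auto simp: matrix_slide_def add_row_def add_column_def)

text \<open>With \<open>b\<close> also in \<open>A\<close>, overwriting row or column
  \<open>a\<close> by that of \<open>b\<close> creates a repetition, so both correction terms
  vanish.\<close>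

lemma principal_minor_slide_both:
  assumes A: "finite A" "a \<in> A" "b \<in> A" "a \<noteq> b"
  shows "principal_minor (matrix_slide a b M) A = principal_minor M A"
proof -
  \<comment> \<open>A general \<open>N\<close> is needed: it becomes \<open>add_column a b M\<close>
    for the row step and the transpose of \<open>M\<close> for the column step.\<close>
  have row: "principal_minor (\<lambda>i. N ((id(a := b)) i)) A = 0" for N :: "'a \<Rightarrow> 'a \<Rightarrow> bit"
    using A(4) by (intro principal_minor_identical_rows[OF A]) simp
  have "principal_minor (\<lambda>i j. M i ((id(a := b)) j)) A
      = principal_minor (\<lambda>i j. M j ((id(a := b)) i)) A"
    by (rule principal_minor_transpose[OF A(1)])
  also have "\<dots> = 0"
    by (rule row[of "\<lambda>i j. M j i"])
  finally show ?thesis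
    by (simp only: matrix_slide_def principal_minor_add_row[OF A(1,2)]
        principal_minor_add_column[OF A(1,2)] row add_0_right)
qed

lemma principal_minor_slide_exchange:
  assumes sym: "symmetric_on E M" and "b \<in> E" "A \<subseteq> E" and A: "finite A" "a \<in> A" and b: "b \<notin> A"
  shows "principal_minor (matrix_slide a b M) A
    = principal_minor M A + principal_minor M (insert b (A - {a}))"
proof -
  define s where "s = id(a := b)"
  have inj: "inj_on s A"
    using b by (auto simp: s_def inj_on_def)
  have img: "s ` A = insert b (A - {a})"
    using A(2) by (auto simp: s_def image_iff)
  \<comment> \<open>Redirecting rows commutes with adding columns, so the column expansion applies
    to both terms of the row expansion.\<close>
  have row_col: "(\<lambda>i. add_column a b M (s i)) = add_column a b (\<lambda>i. M (s i))"
    by (simp add: add_column_def fun_eq_iff)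
  have "principal_minor (\<lambda>i j. M i (s j)) A = principal_minor (\<lambda>i j. M j (s i)) A"
    by (rule principal_minor_transpose[OF A(1)])
  \<comment> \<open>Symmetry applies because \<open>s i\<close> stays in \<open>E\<close>, even when
    it is \<open>b\<close>.\<close>
  also have "\<dots> = principal_minor (\<lambda>i j. M (s i) j) A"
    using assms by (intro principal_minor_cong) (auto simp: s_def symmetric_on_def)
  finally have mixed: "principal_minor (\<lambda>i j. M i (s j)) A = principal_minor (\<lambda>i. M (s i)) A" .
  have "principal_minor (matrix_slide a b M) A
      = (principal_minor M A + principal_minor (\<lambda>i j. M i (s j)) A)
        + (principal_minor (\<lambda>i. M (s i)) A + principal_minor (\<lambda>i j. M (s i) (s j)) A)"
    by (simp only: matrix_slide_def principal_minor_add_row[OF A] s_def[symmetric] row_col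
        principal_minor_add_column[OF A])
  also have "\<dots> = principal_minor M A + principal_minor M (s ` A)"
  proof -
    have "(x + y) + (y + z) = x + z" for x y z :: bit
      by (cases x; cases y; cases z) simp_all
    then show ?thesis
      unfolding mixed principal_minor_image[OF A(1) inj] .
  qed
  finally show ?thesis
    unfolding img .
qed

theorem theorem3p3:
  fixes E :: "'e set" and M :: "'e \<Rightarrow> 'e \<Rightarrow> bit" and a b :: 'e
  assumes "finite E"
    and "symmetric_on E M"
    and "a \<in> E" and "b \<in> E" and "a \<noteq> b"
  shows "matrix_set_system E (matrix_slide a b M) = set_system_slide a b (matrix_set_system E M)"
proof -
  define F where "F = {A. A \<subseteq> E \<and> principal_nonsingular M A}"
  define G where "G = {X \<union> {a} | X. X \<union> {b} \<in> F \<and> X \<subseteq> E - {a, b}}"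
  \<comment> \<open>The set \<open>X\<close> in the definition of \<open>G\<close> is determined by
    \<open>A\<close>: it must be \<open>A - {a}\<close>.\<close>
  have G_iff: "A \<in> G \<longleftrightarrow> a \<in> A \<and> b \<notin> A \<and> principal_nonsingular M (insert b (A - {a}))"
    if "A \<subseteq> E" for A
  proof
    assume "A \<in> G"
    then obtain X where X: "A = insert a X" "principal_nonsingular M (insert b X)" "X \<subseteq> E - {a, b}"
      by (auto simp: F_def G_def)
    moreover from X have "A - {a} = X" by auto
    ultimately show "a \<in> A \<and> b \<notin> A \<and> principal_nonsingular M (insert b (A - {a}))"
      using \<open>a \<noteq> b\<close> by auto
  next
    assume "a \<in> A \<and> b \<notin> A \<and> principal_nonsingular M (insert b (A - {a}))"
    with that \<open>b \<in> E\<close> show "A \<in> G"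
      unfolding G_def F_def by (intro CollectI exI[of _ "A - {a}"]) auto
  qed
  have "principal_nonsingular (matrix_slide a b M) A \<longleftrightarrow> (A \<in> F) \<noteq> (A \<in> G)" if AE: "A \<subseteq> E" for A
  proof -
    have fin: "finite A"
      using AE \<open>finite E\<close> by (rule finite_subset)
    consider "a \<notin> A" | "a \<in> A" "b \<in> A" | "a \<in> A" "b \<notin> A" by blast
    then have "principal_nonsingular (matrix_slide a b M) A \<longleftrightarrow> principal_nonsingular M A \<noteq>
        (a \<in> A \<and> b \<notin> A \<and> principal_nonsingular M (insert b (A - {a})))"
    proof cases
      case 1
      then show ?thesis
        by (simp add: principal_nonsingular_def principal_minor_slide_notin)
    next
      case 2
      then show ?thesis
        using fin \<open>a \<noteq> b\<close> by (simp add: principal_nonsingular_def principal_minor_slide_both)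
    next
      case 3
      \<comment> \<open>Over GF(2) a sum is nonzero iff exactly one summand is, which turns the sum
        of minors into a symmetric difference.\<close>
      have "x + y \<noteq> 0 \<longleftrightarrow> (x \<noteq> 0) \<noteq> (y \<noteq> 0)" for x y :: bit
        by (cases x; cases y) simp_all
      with 3 show ?thesis
        unfolding principal_nonsingular_def
          principal_minor_slide_exchange[OF \<open>symmetric_on E M\<close> \<open>b \<in> E\<close> AE fin 3]
        by blast
    qed
    then show ?thesis
      unfolding G_iff[OF AE] using AE by (simp add: F_def)
  qed
  moreover have "F \<subseteq> Pow E" "G \<subseteq> Pow E"
    using \<open>a \<in> E\<close> by (auto simp: F_def G_def)
  ultimately have "{A. A \<subseteq> E \<and> principal_nonsingular (matrix_slide a b M) A} = sym_diff F G"
    by blast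
  then show ?thesis
    by (simp add: matrix_set_system_def set_system_slide_def F_def G_def)
qed

end
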